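(* Let $N\ge1$ be an integer, $\delta>0$ a real number, $(u_n)_{1\le n\le N}$ a sequence of non-negative real numbers, and $S(\beta)=\sum_{1\le n\le N}u_ne(n\beta)$. (1) Let $a:\mathbb{R}\to\mathbb{R}$ be a non-negative even Riemann-integrable function in $L^2(\mathbb{R})\cap L^1(\mathbb{R})$, not almost everywhere zero, that is non-increasing on $[0,\infty)$. Then $$\int_{-\delta}^{\delta}|S(\beta)|^2d\beta\ge\frac{1}{\delta^{-1}A(a)+B(a)}\int_{-\infty}^\infty\Bigl|\sum_m u_m a(t-m)\Bigr|^2dt,$$ where $A(a)=\|a\|_2^2=\int_{-\infty}^\infty a(t)^2dt$ and $B(a)=\|a\|_1^2=\bigl(\int_{-\infty}^\infty a(t)dt\bigr)^2$. (2) We have $$N\int_{-\delta}^{\delta}|S(\beta)|^2d\beta\ge\biggl(1-\frac{2}{1+\sqrt{\delta N+1}}\biggr)|S(0)|^2.$$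
   Context: $e(x)=\exp(2i\pi x)$. *)

theory Defs
  imports "HOL-Analysis.Analysis"
begin

definition e :: "real \<Rightarrow> complex" where
  "e x = exp (2 * \<i> * complex_of_real pi * complex_of_real x)"

definition exp_sum :: "nat \<Rightarrow> (nat \<Rightarrow> real) \<Rightarrow> real \<Rightarrow> complex" where
  "exp_sum N u \<beta> = (\<Sum>n = 1..N. complex_of_real (u n) * e (real n * \<beta>))"

text \<open>The library's \<open>integrable_on\<close> is gauge (Henstock-Kurzweil) integrability. Riemann
  integrability on a compact interval is the same condition with the gauge replaced by a constant
  mesh bound.\<close>

definition riemann_integrable_on :: "(real \<Rightarrow> real) \<Rightarrow> real \<Rightarrow> real \<Rightarrow> bool" where
  "riemann_integrable_on f c d \<longleftrightarrow>
    (\<exists>I. \<forall>\<epsilon>>0. \<exists>\<eta>>0. \<forall>D. D tagged_division_of {c..d} \<and> (\<forall>(x, K)\<in>D. measure lborel K < \<eta>) \<longrightarrow>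
      \<bar>(\<Sum>(x, K)\<in>D. measure lborel K * f x) - I\<bar> < \<epsilon>)"

text \<open>On the whole line: Riemann integrable on every compact interval. Absolute convergence of the
  improper integral is the separate \<open>L\<^sup>1\<close> condition.\<close>

definition riemann_integrable :: "(real \<Rightarrow> real) \<Rightarrow> bool" where
  "riemann_integrable f \<longleftrightarrow> (\<forall>c d. c \<le> d \<longrightarrow> riemann_integrable_on f c d)"

definition A_const :: "(real \<Rightarrow> real) \<Rightarrow> real" where
  "A_const a = (LINT t|lborel. (a t)\<^sup>2)"

definition B_const :: "(real \<Rightarrow> real) \<Rightarrow> real" where
  "B_const a = (LINT t|lborel. a t)\<^sup>2"

end

theory Submission
  imports Defs
begin

text \<open>
  Write \<open>I\<close> for the integral of \<open>|S|\<^sup>2\<close> over \<open>[-\<delta>, \<delta>]\<close>. Selberg's majorant of the indicator of \<open>[-y, y]\<close>, whose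
  Fourier transform is supported in \<open>[-\<delta>, \<delta>]\<close> and bounded by its integral \<open>2 y + 1 / \<delta>\<close>, gives
  \<open>\<Sum> u m * u n \<le> (2 y + 1 / \<delta>) I\<close>, the sum being over the pairs with \<open>|m - n| \<le> y\<close>, because the \<open>u n\<close> are
  nonnegative. The autocorrelation \<open>D\<close> of \<open>a\<close> is again even, nonnegative and nonincreasing on
  \<open>[0, \<infinity>)\<close>, so it is a positive combination of such indicators, and
  \<open>\<Sum> u m * u n * D (m - n) \<le> (D 0 / \<delta> + \<integral> D) I\<close>; this is the first part, since \<open>D 0\<close> is \<open>A\<close> and
  \<open>\<integral> D\<close> is \<open>B\<close>. The second part takes for \<open>a\<close> the indicator of an interval of length \<open>M = sqrt (N / \<delta>)\<close>
  and applies the Cauchy--Schwarz inequality, the smoothed sum being supported on an interval of length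
  at most \<open>N + M\<close>.

  For the majorant, the approximation \<open>H\<close> to the sign function and the Fejer kernel \<open>K\<close> are defined
  by their Fourier integrals. For \<open>x > 0\<close> the difference \<open>H (x + 1) - H x\<close> is elementary; it shows that
  \<open>H\<close> increases and \<open>H + K\<close> decreases along \<open>x, x + 1, x + 2, \<dots>\<close>. Both tend to 1 by the
  Riemann--Lebesgue lemma, so \<open>H \<le> 1 \<le> H + K\<close>.
\<close>

section \<open>Beurling's approximation to the sign function\<close>

abbreviation unit_interval_measure :: "real measure" where
  "unit_interval_measure \<equiv> restrict_space lborel {0<..<1}"

lemma space_unit: "space unit_interval_measure = {0<..<1}"
  by (simp add: space_restrict_space)

lemma finite_measure_unit: "finite_measure unit_interval_measure"
  by (rule finite_measureI) (simp add: emeasure_restrict_space space_restrict_space)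

lemma integrable_unit:
  fixes f :: "real \<Rightarrow> real"
  assumes "f \<in> borel_measurable borel" "\<And>b. 0 < b \<Longrightarrow> b < 1 \<Longrightarrow> \<bar>f b\<bar> \<le> C"
  shows "integrable unit_interval_measure f"
proof -
  interpret finite_measure unit_interval_measure by (rule finite_measure_unit)
  have "f \<in> borel_measurable unit_interval_measure"
    using assms(1) by (simp add: measurable_restrict_space1)
  moreover have "AE b in unit_interval_measure. norm (f b) \<le> C"
    using assms(2) by (intro AE_I2) (simp add: space_unit)
  ultimately show ?thesis by (rule integrable_const_bound[rotated])
qed

lemma integral_unit_cong:
  "(\<And>b. 0 < b \<Longrightarrow> b < 1 \<Longrightarrow> f b = g b) \<Longrightarrow>
    integral\<^sup>L unit_interval_measure f = integral\<^sup>L unit_interval_measure (g :: real \<Rightarrow> real)"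
  by (rule Bochner_Integration.integral_cong) (auto simp: space_unit)

lemma integral_unit_FTC:
  fixes f F :: "real \<Rightarrow> real"
  assumes "continuous_on {0..1} f" "\<And>b. (F has_real_derivative f b) (at b)"
  shows "integral\<^sup>L unit_interval_measure f = F 1 - F 0"
proof -
  have "(LBINT b=ereal 0..ereal 1. f b) = F 1 - F 0"
    using assms
    by (intro interval_integral_FTC_finite)
       (auto intro: DERIV_subset simp: has_real_derivative_iff_has_vector_derivative[symmetric])
  then show ?thesis
    by (simp add: integral_restrict_space interval_integral_Ioo set_lebesgue_integral_def)
qed

lemma integral_unit_cos:
  assumes "x \<noteq> 0"
  shows "(LINT b|unit_interval_measure. cos (2 * pi * b * x)) = sin (2 * pi * x) / (2 * pi * x)"
proof -
  have "(LINT b|unit_interval_measure. cos (2 * pi * b * x))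
      = sin (2 * pi * 1 * x) / (2 * pi * x) - sin (2 * pi * 0 * x) / (2 * pi * x)"
    using assms
    by (intro integral_unit_FTC) (auto intro!: continuous_intros derivative_eq_intros)
  then show ?thesis by simp
qed

lemma one_minus_cos: "1 - cos (2 * pi * x) = 2 * (sin (pi * x))\<^sup>2" for x :: real
  using cos_double_sin[of "pi * x"] by (simp add: mult.assoc)

lemma integral_unit_sin:
  assumes "x \<noteq> 0"
  shows "(LINT b|unit_interval_measure. sin (2 * pi * b * x)) = (sin (pi * x))\<^sup>2 / (pi * x)"
proof -
  have "(LINT b|unit_interval_measure. sin (2 * pi * b * x))
      = - cos (2 * pi * 1 * x) / (2 * pi * x) - - cos (2 * pi * 0 * x) / (2 * pi * x)"
    using assms
    by (intro integral_unit_FTC) (auto intro!: continuous_intros derivative_eq_intros)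
  also have "\<dots> = (1 - cos (2 * pi * x)) / (2 * pi * x)"
    using assms by (simp add: field_simps)
  finally show ?thesis
    using assms by (simp add: one_minus_cos)
qed

text \<open>The Fourier integral of the triangle function on \<open>[-1, 1]\<close>, folded onto
  positive frequencies; folding produces the factor 2 and the cosine.\<close>

definition fejer :: "real \<Rightarrow> real" where
  "fejer x = (LINT b|unit_interval_measure. 2 * (1 - b) * cos (2 * pi * b * x))"

lemma fejer_0: "fejer 0 = 1"
proof -
  have "(LINT b|unit_interval_measure. 2 * (1 - b)) = (2 * 1 - 1\<^sup>2) - (2 * 0 - 0\<^sup>2 :: real)"
    by (intro integral_unit_FTC) (auto intro!: continuous_intros derivative_eq_intros)
  then show ?thesis by (simp add: fejer_def)
qed

lemma fejer_eq:
  assumes "x \<noteq> 0"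
  shows "fejer x = (sin (pi * x))\<^sup>2 / (pi * x)\<^sup>2"
proof -
  let ?F = "\<lambda>b. (1 - b) * sin (2 * pi * b * x) / (pi * x) - cos (2 * pi * b * x) / (2 * (pi * x)\<^sup>2)"
  have "fejer x = ?F 1 - ?F 0"
    unfolding fejer_def using assms
    by (intro integral_unit_FTC)
       (auto intro!: continuous_intros derivative_eq_intros simp: field_simps power2_eq_square)
  also have "\<dots> = (1 - cos (2 * pi * x)) / (2 * (pi * x)\<^sup>2)"
    using assms by (simp add: field_simps)
  finally show ?thesis
    using assms by (simp add: one_minus_cos)
qed

section \<open>Vaaler's function and the density of Beurling's function\<close>

lemma mult_cos_le_sin:
  assumes "0 \<le> x" "x \<le> pi"
  shows "x * cos x \<le> sin (x :: real)"
proof -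
  have "\<exists>d. ((\<lambda>x. sin x - x * cos x) has_real_derivative d) (at y) \<and> d \<ge> 0"
    if "0 \<le> y" "y \<le> x" for y
  proof (intro exI conjI)
    show "((\<lambda>x. sin x - x * cos x) has_real_derivative y * sin y) (at y)"
      by (auto intro!: derivative_eq_intros)
    show "0 \<le> y * sin y"
      using that assms by (intro mult_nonneg_nonneg sin_ge_zero) auto
  qed
  then have "sin 0 - 0 * cos 0 \<le> sin x - x * cos x"
    using assms(1) by (rule DERIV_nonneg_imp_nondecreasing[rotated])
  then show ?thesis by simp
qed

text \<open>On \<open>0 < b < 1\<close> this is Vaaler's closed form for the Fourier transform of
  half the derivative of Beurling's odd function; integrating back divides by the frequency.\<close>

definition vaaler :: "real \<Rightarrow> real" where
  "vaaler b = pi * b * (1 - b) * cot (pi * b) + b"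

text \<open>Both bounds come from \<open>c * cot c \<le> 1\<close> on \<open>(0, pi)\<close>. At
  \<open>c = pi * b\<close> it bounds the cotangent term by \<open>1 - b\<close>; at the reflected
  point \<open>c = pi * (1 - b)\<close>, where the cotangent changes sign, it bounds that term below
  by \<open>- b\<close>.\<close>

lemma vaaler_bounds:
  assumes "0 < b" "b < 1"
  shows "0 \<le> vaaler b" "vaaler b \<le> 1"
proof -
  have le: "pi * c * cot (pi * c) \<le> 1" if "0 < c" "c < 1" for c :: real
  proof -
    have "sin (pi * c) > 0"
      using that by (intro sin_gt_zero) auto
    moreover have "pi * c * cos (pi * c) \<le> sin (pi * c)"
      using that by (intro mult_cos_le_sin) auto
    ultimately show ?thesis by (simp add: cot_def field_simps)
  qed
  have "(1 - b) * (pi * b * cot (pi * b)) \<le> (1 - b) * 1"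
    using assms by (intro mult_left_mono le) auto
  then show "vaaler b \<le> 1"
    by (simp add: vaaler_def algebra_simps)
  have "cot (pi * (1 - b)) = - cot (pi * b)"
    by (simp add: cot_def right_diff_distrib sin_diff cos_diff)
  moreover have "b * (pi * (1 - b) * cot (pi * (1 - b))) \<le> b * 1"
    using assms by (intro mult_left_mono le) auto
  ultimately show "0 \<le> vaaler b"
    by (simp add: vaaler_def algebra_simps)
qed

text \<open>This is \<open>2 * vaaler b / (pi * b)\<close>; the sine transform of it is Beurling's odd approximation
  \<open>beurling\<close> to the sign function.\<close>

definition beurling_dens :: "real \<Rightarrow> real" where
  "beurling_dens b = 2 * (1 - b) * cot (pi * b) + 2 / pi"

text \<open>The density grows like \<open>2 / (pi * b)\<close> near 0, and the zero of the sine
  cancels this pole. The sine transform thus has a bounded integrand.\<close>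

lemma beurling_dens_sin_le:
  assumes "0 < b" "b < 1"
  shows "\<bar>beurling_dens b * sin (2 * pi * b * x)\<bar> \<le> 4 * \<bar>x\<bar>"
proof -
  have "beurling_dens b = 2 * vaaler b / (pi * b)"
    using assms by (simp add: beurling_dens_def vaaler_def field_simps)
  then have "\<bar>beurling_dens b\<bar> \<le> 2 / (pi * b)"
    using vaaler_bounds[OF assms] assms by (simp add: field_simps)
  moreover have "\<bar>sin (2 * pi * b * x)\<bar> \<le> 2 * pi * b * \<bar>x\<bar>"
    using abs_sin_x_le_abs_x[of "2 * pi * b * x"] assms by (simp add: abs_mult)
  ultimately have "\<bar>beurling_dens b\<bar> * \<bar>sin (2 * pi * b * x)\<bar> \<le> 2 / (pi * b) * (2 * pi * b * \<bar>x\<bar>)"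
    using assms by (intro mult_mono) auto
  then show ?thesis
    using assms by (simp add: abs_mult field_simps)
qed

lemma borel_measurable_beurling_dens [measurable]: "beurling_dens \<in> borel_measurable borel"
  unfolding beurling_dens_def cot_def by measurable

definition beurling :: "real \<Rightarrow> real" where
  "beurling x = (LINT b|unit_interval_measure. beurling_dens b * sin (2 * pi * b * x))"

lemma integrable_beurling:
  "integrable unit_interval_measure (\<lambda>b. beurling_dens b * sin (2 * pi * b * x))"
  by (rule integrable_unit[OF _ beurling_dens_sin_le]) simp_all

lemma beurling_minus: "beurling (- x) = - beurling x"
  by (simp add: beurling_def)

lemma integrable_fejer:
  "integrable unit_interval_measure (\<lambda>b. 2 * (1 - b) * cos (2 * pi * b * x))"
proof (rule integrable_unit)
  show "\<bar>2 * (1 - b) * cos (2 * pi * b * x)\<bar> \<le> 2 * 1 * 1" if "0 < b" "b < 1" for b :: real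
    unfolding abs_mult using that by (intro mult_mono) auto
qed measurable

section \<open>Unit steps of Beurling's function\<close>

text \<open>With \<open>p = pi * b\<close> the two sines have arguments \<open>q + p\<close> and
  \<open>q - p\<close>, so their difference is \<open>2 * cos q * sin p\<close>. The factor
  \<open>sin p\<close> cancels the denominator of the cotangent, and
  \<open>2 * cos p * cos q\<close> splits into the two cosines of the Fejer integrals.\<close>

lemma beurling_step:
  "beurling (x + 1) - beurling x = fejer (x + 1) + fejer x + 2 / pi *
    ((LINT b|unit_interval_measure. sin (2 * pi * b * (x + 1)))
      - (LINT b|unit_interval_measure. sin (2 * pi * b * x)))"
proof -
  have int_sin: "integrable unit_interval_measure (\<lambda>b. sin (2 * pi * b * y))" for y
    by (rule integrable_unit[where C = 1]) auto
  have eq: "beurling_dens b * sin (2 * pi * b * (x + 1)) - beurling_dens b * sin (2 * pi * b * x)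
      = 2 * (1 - b) * cos (2 * pi * b * (x + 1)) + 2 * (1 - b) * cos (2 * pi * b * x)
        + 2 / pi * (sin (2 * pi * b * (x + 1)) - sin (2 * pi * b * x))"
    if "0 < b" "b < 1" for b
  proof -
    define p q where "p = pi * b" and "q = pi * b * (2 * x + 1)"
    have "sin p > 0"
      unfolding p_def using that by (intro sin_gt_zero) auto
    have args: "2 * pi * b * (x + 1) = q + p" "2 * pi * b * x = q - p"
      by (simp_all add: p_def q_def algebra_simps)
    have dens: "beurling_dens b = 2 * (1 - b) * (cos p / sin p) + 2 / pi"
      by (simp add: beurling_dens_def cot_def p_def)
    show ?thesis
      unfolding args dens sin_add sin_diff cos_add cos_diff
      using \<open>sin p > 0\<close> by (simp add: field_simps)
  qed
  have "beurling (x + 1) - beurling x = (LINT b|unit_interval_measure.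
      beurling_dens b * sin (2 * pi * b * (x + 1)) - beurling_dens b * sin (2 * pi * b * x))"
    unfolding beurling_def
    by (rule Bochner_Integration.integral_diff[symmetric]) (rule integrable_beurling)+
  also have "\<dots> = (LINT b|unit_interval_measure.
      2 * (1 - b) * cos (2 * pi * b * (x + 1)) + 2 * (1 - b) * cos (2 * pi * b * x)
        + 2 / pi * (sin (2 * pi * b * (x + 1)) - sin (2 * pi * b * x)))"
    by (rule integral_unit_cong) (rule eq)
  also have "\<dots> = fejer (x + 1) + fejer x + 2 / pi *
    ((LINT b|unit_interval_measure. sin (2 * pi * b * (x + 1)))
      - (LINT b|unit_interval_measure. sin (2 * pi * b * x)))"
    unfolding fejer_def
    by (subst Bochner_Integration.integral_add
          Bochner_Integration.integral_diff integral_mult_right_zero;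
        (intro Bochner_Integration.integrable_add Bochner_Integration.integrable_diff
          integrable_mult_right integrable_fejer int_sin)?)+ simp
  finally show ?thesis .
qed

lemma sin_pi_add_one_sq: "(sin (pi * (x + 1)))\<^sup>2 = (sin (pi * x))\<^sup>2" for x :: real
  by (simp add: distrib_left sin_add)

text \<open>All terms share the factor \<open>(sin (pi * x))\<^sup>2\<close>, which has period 1. As
  \<open>1 / x - 1 / (x + 1)\<close> equals \<open>1 / (x * (x + 1))\<close>, the contribution of
  the sine integrals is exactly the cross term that completes the square.\<close>

lemma beurling_step_pos:
  assumes "x > 0"
  shows "beurling (x + 1) - beurling x = (sin (pi * x))\<^sup>2 / pi\<^sup>2 * (1 / x - 1 / (x + 1))\<^sup>2"
proof -
  have "beurling (x + 1) - beurling x = (sin (pi * x))\<^sup>2 / (pi * (x + 1))\<^sup>2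
      + (sin (pi * x))\<^sup>2 / (pi * x)\<^sup>2
      + 2 / pi * ((sin (pi * x))\<^sup>2 / (pi * (x + 1)) - (sin (pi * x))\<^sup>2 / (pi * x))"
    using assms
    by (simp add: beurling_step fejer_eq integral_unit_sin sin_pi_add_one_sq del: distrib_left_numeral)
  also have "\<dots> = (sin (pi * x))\<^sup>2 / pi\<^sup>2 *
      (1 / (x + 1)\<^sup>2 + 1 / x\<^sup>2 + 2 * (1 / (x + 1) - 1 / x))"
    by (simp add: power_mult_distrib algebra_simps power2_eq_square add_divide_distrib diff_divide_distrib)
  also have "1 / (x + 1)\<^sup>2 + 1 / x\<^sup>2 + 2 * (1 / (x + 1) - 1 / x) = (1 / x - 1 / (x + 1))\<^sup>2"
    using assms by (simp add: divide_simps) (simp add: power2_eq_square algebra_simps)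
  finally show ?thesis .
qed

text \<open>The first step, from 0 to 1, contributes only \<open>fejer 0 = 1\<close>; every later
  step vanishes with \<open>sin (pi * n)\<close>. These values anchor the limit at infinity in
  \<open>beurling_tendsto_1\<close>.\<close>

lemma beurling_nat: "beurling (real (Suc n)) = 1"
proof (induction n)
  case 0
  have "beurling (0 + 1) - beurling 0 = fejer (0 + 1) + fejer 0
      + 2 / pi * ((LINT b|unit_interval_measure. sin (2 * pi * b * (0 + 1))) - 0)"
    by (subst beurling_step) simp
  then show ?case
    using integral_unit_sin[of 1] by (simp add: fejer_eq fejer_0 beurling_def)
next
  case (Suc n)
  have "beurling (real (Suc n) + 1) - beurling (real (Suc n)) = 0"
    by (subst beurling_step_pos) (auto simp: mult.commute[of pi] simp del: of_nat_Suc)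
  with Suc show ?case
    by (simp add: add.commute)
qed

lemma fejer_diff:
  assumes "x > 0"
  shows "fejer x - fejer (x + 1)
    = (sin (pi * x))\<^sup>2 / pi\<^sup>2 * ((1 / x - 1 / (x + 1)) * (1 / x + 1 / (x + 1)))"
proof -
  have "fejer x - fejer (x + 1)
      = (sin (pi * x))\<^sup>2 / pi\<^sup>2 * (1 / x\<^sup>2 - 1 / (x + 1)\<^sup>2)"
    using assms
    by (simp add: fejer_eq sin_pi_add_one_sq power_mult_distrib right_diff_distrib del: distrib_left_numeral)
  also have "1 / x\<^sup>2 - 1 / (x + 1)\<^sup>2 = (1 / x - 1 / (x + 1)) * (1 / x + 1 / (x + 1))"
    by (simp add: algebra_simps power2_eq_square)
  finally show ?thesis .
qed

lemma beurling_mono_step: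
  assumes "x > 0"
  shows "beurling x \<le> beurling (x + 1)"
proof -
  have "0 \<le> beurling (x + 1) - beurling x"
    unfolding beurling_step_pos[OF assms] by simp
  then show ?thesis by simp
qed

text \<open>The gain of \<open>beurling\<close> and the loss of \<open>fejer\<close> over a unit
  step have the same prefactor. What remains is
  \<open>(p - q)\<^sup>2 \<le> (p - q) * (p + q)\<close> for \<open>p = 1 / x\<close> and
  \<open>q = 1 / (x + 1)\<close>.\<close>

lemma beurling_fejer_antimono_step:
  assumes "x > 0"
  shows "beurling (x + 1) + fejer (x + 1) \<le> beurling x + fejer x"
proof -
  have "(1 / x - 1 / (x + 1))\<^sup>2 \<le> (1 / x - 1 / (x + 1)) * (1 / x + 1 / (x + 1))"
    unfolding power2_eq_square using assms
    by (intro mult_left_mono) (simp_all add: frac_le)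
  then have "beurling (x + 1) - beurling x \<le> fejer x - fejer (x + 1)"
    unfolding beurling_step_pos[OF assms] fejer_diff[OF assms]
    by (intro mult_left_mono) auto
  then show ?thesis by simp
qed

section \<open>Bessel's inequality and the Riemann-Lebesgue lemma\<close>

text \<open>Bessel's inequality: the squared distance from \<open>G\<close> to each partial
  orthogonal expansion is nonnegative, so the squared coefficients are summable and tend to
  0.\<close>

lemma bessel_tendsto_zero:
  fixes \<phi> :: "nat \<Rightarrow> 'a \<Rightarrow> real"
  assumes G: "integrable M (\<lambda>x. (G x)\<^sup>2)"
    and G\<phi>: "\<And>n. integrable M (\<lambda>x. G x * \<phi> n x)"
    and \<phi>\<phi>: "\<And>m n. integrable M (\<lambda>x. \<phi> m x * \<phi> n x)"
    and ortho: "\<And>m n. (LINT x|M. \<phi> m x * \<phi> n x) = (if m = n then c else 0)"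
    and "c > 0"
  shows "(\<lambda>n. LINT x|M. G x * \<phi> n x) \<longlonglongrightarrow> 0"
proof -
  define d where "d n = (LINT x|M. G x * \<phi> n x) / c" for n
  have Gd: "(LINT x|M. G x * \<phi> n x) = c * d n" for n
    using \<open>c > 0\<close> by (simp add: d_def)
  have bound: "(\<Sum>n<k. (d n)\<^sup>2) \<le> (LINT x|M. (G x)\<^sup>2) / c" for k
  proof -
    have expand: "(G x - (\<Sum>n<k. d n * \<phi> n x))\<^sup>2 = (G x)\<^sup>2 - (\<Sum>n<k. 2 * d n * (G x * \<phi> n x))
        + (\<Sum>m<k. \<Sum>n<k. d m * d n * (\<phi> m x * \<phi> n x))" for x
    proof -
      have "(\<Sum>m<k. \<Sum>n<k. d m * d n * (\<phi> m x * \<phi> n x)) = (\<Sum>n<k. d n * \<phi> n x)\<^sup>2"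
        unfolding power2_eq_square sum_product by (simp add: mult_ac)
      then show ?thesis
        by (simp add: power2_diff sum_distrib_left mult_ac)
    qed
    have "0 \<le> (LINT x|M. (G x - (\<Sum>n<k. d n * \<phi> n x))\<^sup>2)"
      by simp
    also have "\<dots> = (LINT x|M. (G x)\<^sup>2) - (\<Sum>n<k. 2 * d n * (LINT x|M. G x * \<phi> n x))
        + (\<Sum>m<k. \<Sum>n<k. d m * d n * (LINT x|M. \<phi> m x * \<phi> n x))"
      unfolding expand
      by (simp add: G G\<phi> \<phi>\<phi> Bochner_Integration.integral_sum)
    also have "\<dots> = (LINT x|M. (G x)\<^sup>2) - c * (\<Sum>n<k. (d n)\<^sup>2)"
      by (simp add: ortho Gd if_distrib sum_distrib_left power2_eq_square mult_ac cong: if_cong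
          flip: sum_subtractf) (simp add: sum_distrib_left sum_negf algebra_simps)
    finally show ?thesis
      using \<open>c > 0\<close> by (simp add: field_simps)
  qed
  have "summable (\<lambda>n. (d n)\<^sup>2)"
    by (rule bounded_imp_summable[where B = "(LINT x|M. (G x)\<^sup>2) / c"])
       (use bound[of "Suc _"] in \<open>auto simp: lessThan_Suc_atMost\<close>)
  then have "(\<lambda>n. (d n)\<^sup>2) \<longlonglongrightarrow> 0"
    by (rule summable_LIMSEQ_zero)
  then have "(\<lambda>n. c * d n) \<longlonglongrightarrow> c * 0"
    by (intro tendsto_mult tendsto_const) (simp add: power_tendsto_0_iff)
  then show ?thesis by (simp add: Gd)
qed

lemma integral_unit_cos_int:
  "(LINT b|unit_interval_measure. cos (2 * pi * b * real_of_int k)) = (if k = 0 then 1 else 0)"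
proof (cases "k = 0")
  case True
  have "(LINT b|unit_interval_measure. 1) = 1 - (0 :: real)"
    by (intro integral_unit_FTC) (auto intro!: continuous_intros derivative_eq_intros)
  with True show ?thesis by simp
next
  case False
  have "sin (2 * pi * real_of_int k) = 0"
    by (rule sin_integer_2pi) simp
  then show ?thesis
    using False integral_unit_cos[of "real_of_int k"] by simp
qed

lemma integral_unit_trig_ortho:
  fixes m n :: nat
  shows "(LINT b|unit_interval_measure. cos (2 * pi * b * real (Suc m)) * cos (2 * pi * b * real (Suc n)))
      = (if m = n then 1 / 2 else 0)"
    and "(LINT b|unit_interval_measure. sin (2 * pi * b * real (Suc m)) * sin (2 * pi * b * real (Suc n)))
      = (if m = n then 1 / 2 else 0)"
proof -
  let ?c = "\<lambda>k b. cos (2 * pi * b * real_of_int k)"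
  \<comment> \<open>Difference and sum of the frequencies \<open>Suc m\<close> and
    \<open>Suc n\<close>. The shift by \<open>Suc\<close> excludes frequency 0, so \<open>k\<close>
    never vanishes and only the difference can contribute to the integral.\<close>
  define j k where "j = int m - int n" and "k = int m + int n + 2"
  have int_cos: "integrable unit_interval_measure (?c i)" for i
    by (rule integrable_unit[where C = 1]) auto
  have args: "2 * pi * b * real (Suc m) - 2 * pi * b * real (Suc n) = 2 * pi * b * real_of_int j"
    "2 * pi * b * real (Suc m) + 2 * pi * b * real (Suc n) = 2 * pi * b * real_of_int k" for b
    by (simp_all add: j_def k_def algebra_simps)
  have "k \<noteq> 0" by (simp add: k_def)
  show "(LINT b|unit_interval_measure. cos (2 * pi * b * real (Suc m)) * cos (2 * pi * b * real (Suc n)))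
      = (if m = n then 1 / 2 else 0)"
    unfolding cos_times_cos args using \<open>k \<noteq> 0\<close>
    by (simp add: int_cos integral_unit_cos_int) (auto simp: j_def)
  show "(LINT b|unit_interval_measure. sin (2 * pi * b * real (Suc m)) * sin (2 * pi * b * real (Suc n)))
      = (if m = n then 1 / 2 else 0)"
    unfolding sin_times_sin args using \<open>k \<noteq> 0\<close>
    by (simp add: int_cos integral_unit_cos_int) (auto simp: j_def)
qed

text \<open>A bounded function is square integrable on the unit interval, so Bessel's inequality
  applies with the common squared norm 1/2. Integer frequencies suffice: along
  \<open>x + real (Suc n)\<close> the part depending on \<open>x\<close> is absorbed into
  \<open>G\<close>.\<close>

lemma riemann_lebesgue_unit:
  fixes G :: "real \<Rightarrow> real"
  assumes [measurable]: "G \<in> borel_measurable borel"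
    and bound: "\<And>b. 0 < b \<Longrightarrow> b < 1 \<Longrightarrow> \<bar>G b\<bar> \<le> C"
  shows "(\<lambda>n. LINT b|unit_interval_measure. G b * cos (2 * pi * b * real (Suc n))) \<longlonglongrightarrow> 0"
    and "(\<lambda>n. LINT b|unit_interval_measure. G b * sin (2 * pi * b * real (Suc n))) \<longlonglongrightarrow> 0"
proof -
  have int: "integrable unit_interval_measure (\<lambda>b. f b * g b)"
    if [measurable]: "f \<in> borel_measurable borel" "g \<in> borel_measurable borel"
      and "\<And>b. 0 < b \<Longrightarrow> b < 1 \<Longrightarrow> \<bar>f b\<bar> \<le> C1" "\<And>b. \<bar>g b\<bar> \<le> 1" for f g :: "real \<Rightarrow> real" and C1
  proof (rule integrable_unit)
    show "\<bar>f b * g b\<bar> \<le> C1 * 1" if "0 < b" "b < 1" for b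
      unfolding abs_mult using \<open>\<And>b. 0 < b \<Longrightarrow> b < 1 \<Longrightarrow> \<bar>f b\<bar> \<le> C1\<close>[OF that] \<open>\<And>b. \<bar>g b\<bar> \<le> 1\<close>[of b]
      by (intro mult_mono) auto
  qed measurable
  have sq: "integrable unit_interval_measure (\<lambda>b. (G b)\<^sup>2)"
  proof (rule integrable_unit)
    show "\<bar>(G b)\<^sup>2\<bar> \<le> C\<^sup>2" if "0 < b" "b < 1" for b
      using power_mono[OF bound[OF that], of 2] by simp
  qed measurable
  have half: "0 < (1 / 2 :: real)" by simp
  show "(\<lambda>n. LINT b|unit_interval_measure. G b * cos (2 * pi * b * real (Suc n))) \<longlonglongrightarrow> 0"
    by (rule bessel_tendsto_zero[where c = "1/2"])
       ((rule half sq integral_unit_trig_ortho(1) int[OF _ _ bound] int[where ?C1.0 = 1]); simp?)+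
  show "(\<lambda>n. LINT b|unit_interval_measure. G b * sin (2 * pi * b * real (Suc n))) \<longlonglongrightarrow> 0"
    by (rule bessel_tendsto_zero[where c = "1/2"])
       ((rule half sq integral_unit_trig_ortho(2) int[OF _ _ bound] int[where ?C1.0 = 1]); simp?)+
qed

text \<open>The density is not integrable at 0, so the Riemann-Lebesgue lemma is applied to the
  difference from \<open>beurling (real (Suc n)) = 1\<close> instead. That difference carries a
  factor vanishing at \<open>b = 0\<close>.\<close>

lemma beurling_tendsto_1: "(\<lambda>n. beurling (x + real (Suc n))) \<longlonglongrightarrow> 1"
proof -
  \<comment> \<open>From \<open>sin (r + 2 * p) - sin r = 2 * sin p * cos (r + p)\<close> with
    \<open>p = pi * b * x\<close>: the factor \<open>2 * sin p\<close> makes the density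
    bounded.\<close>
  define G where "G b = 2 * (beurling_dens b * sin (2 * pi * b * (x / 2)))" for b
  have [measurable]: "G \<in> borel_measurable borel"
    unfolding G_def by measurable
  have G_le: "\<bar>G b * t\<bar> \<le> 4 * \<bar>x\<bar>" if "0 < b" "b < 1" "\<bar>t\<bar> \<le> 1" for b t
  proof -
    have "\<bar>G b\<bar> * \<bar>t\<bar> \<le> (4 * \<bar>x\<bar>) * 1"
      using beurling_dens_sin_le[OF that(1,2), of "x / 2"] that(3)
      by (intro mult_mono) (auto simp: G_def)
    then show ?thesis by (simp add: abs_mult)
  qed
  have int: "integrable unit_interval_measure (\<lambda>b. G b * s b * t b)"
    if "s \<in> borel_measurable borel" "t \<in> borel_measurable borel" "\<And>b. \<bar>s b\<bar> \<le> 1" "\<And>b. \<bar>t b\<bar> \<le> 1"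
    for s t :: "real \<Rightarrow> real"
  proof (rule integrable_unit)
    show "\<bar>G b * s b * t b\<bar> \<le> 4 * \<bar>x\<bar>" if "0 < b" "b < 1" for b
      using G_le[OF that, of "s b * t b"] mult_mono[OF \<open>\<And>b. \<bar>s b\<bar> \<le> 1\<close>[of b] \<open>\<And>b. \<bar>t b\<bar> \<le> 1\<close>[of b]]
      by (simp add: abs_mult mult.assoc)
  qed (use that in measurable)
  have "beurling (x + real (Suc n)) - beurling (real (Suc n))
      = (LINT b|unit_interval_measure. (G b * cos (pi * b * x)) * cos (2 * pi * b * real (Suc n)))
        - (LINT b|unit_interval_measure. (G b * sin (pi * b * x)) * sin (2 * pi * b * real (Suc n)))" for n
  proof -
    have "G b * cos (pi * b * x) * cos (2 * pi * b * real (Suc n))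
          - G b * sin (pi * b * x) * sin (2 * pi * b * real (Suc n))
        = beurling_dens b * sin (2 * pi * b * (x + real (Suc n)))
          - beurling_dens b * sin (2 * pi * b * real (Suc n))" for b
    proof -
      define p r where "p = pi * b * x" and "r = 2 * pi * b * real (Suc n)"
      have args: "2 * pi * b * (x + real (Suc n)) = r + 2 * p" "2 * pi * b * (x / 2) = p"
        by (simp_all add: p_def r_def algebra_simps)
      have "sin (r + 2 * p) - sin r = 2 * sin p * (cos p * cos r - sin p * sin r)"
      proof -
        have "cos (2 * p) = 1 - 2 * (sin p)\<^sup>2"
          by (rule cos_double_sin)
        then show ?thesis
          unfolding sin_add sin_double by (simp only:) (simp add: algebra_simps power2_eq_square)
      qed
      then have "beurling_dens b * (sin (r + 2 * p) - sin r)
          = beurling_dens b * (2 * sin p * (cos p * cos r - sin p * sin r))"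
        by simp
      then show ?thesis
        unfolding G_def args p_def[symmetric] r_def[symmetric] by (simp add: algebra_simps)
    qed
    note eq = this
    have "integrable unit_interval_measure (\<lambda>b. G b * cos (pi * b * x) * cos (2 * pi * b * real (Suc n)))"
      "integrable unit_interval_measure (\<lambda>b. G b * sin (pi * b * x) * sin (2 * pi * b * real (Suc n)))"
      by (rule int; simp)+
    from Bochner_Integration.integral_diff[OF this] show ?thesis
      unfolding beurling_def eq
      by (simp only: Bochner_Integration.integral_diff integrable_beurling)
  qed
  note diff = this
  have "(\<lambda>n. beurling (x + real (Suc n)) - beurling (real (Suc n))) \<longlonglongrightarrow> 0 - 0"
    unfolding diff
    by (intro tendsto_diff riemann_lebesgue_unit[where C = "4 * \<bar>x\<bar>"] G_le) auto
  then have "(\<lambda>n. beurling (x + real (Suc n)) - beurling (real (Suc n)) + 1) \<longlonglongrightarrow> 0 + 1"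
    by (intro tendsto_add tendsto_const) simp
  then show ?thesis by (simp only: beurling_nat) simp
qed

lemma fejer_nonneg: "0 \<le> fejer x"
  by (cases "x = 0") (simp_all add: fejer_0 fejer_eq)

lemma fejer_tendsto_0: "(\<lambda>n. fejer (x + real (Suc n))) \<longlonglongrightarrow> 0"
  unfolding fejer_def
proof -
  have args: "2 * (1 - b) * cos (2 * pi * b * (x + real (Suc n)))
     = 2 * (1 - b) * cos (2 * pi * b * x) * cos (2 * pi * b * real (Suc n))
       - 2 * (1 - b) * sin (2 * pi * b * x) * sin (2 * pi * b * real (Suc n))" for b n
    by (simp add: distrib_left cos_add algebra_simps del: of_nat_Suc)
  have le: "\<bar>2 * (1 - b) * t\<bar> \<le> 2 * 1 * 1" if "0 < b" "b < 1" "\<bar>t\<bar> \<le> 1" for b t :: real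
    unfolding abs_mult using that by (intro mult_mono) auto
  have int: "integrable unit_interval_measure (\<lambda>b. 2 * (1 - b) * s b * t b)"
    if "s \<in> borel_measurable borel" "t \<in> borel_measurable borel" "\<And>b. \<bar>s b\<bar> \<le> 1" "\<And>b. \<bar>t b\<bar> \<le> 1"
    for s t :: "real \<Rightarrow> real"
  proof (rule integrable_unit)
    show "\<bar>2 * (1 - b) * s b * t b\<bar> \<le> 2 * 1 * 1" if "0 < b" "b < 1" for b
      using le[OF that, of "s b * t b"] mult_mono[OF \<open>\<And>b. \<bar>s b\<bar> \<le> 1\<close>[of b] \<open>\<And>b. \<bar>t b\<bar> \<le> 1\<close>[of b]]
      by (simp add: abs_mult mult.assoc)
  qed (use that in measurable)
  have int_cos: "integrable unit_interval_measure
        (\<lambda>b. 2 * (1 - b) * cos (2 * pi * b * x) * cos (2 * pi * b * real (Suc n)))"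
    and int_sin: "integrable unit_interval_measure
        (\<lambda>b. 2 * (1 - b) * sin (2 * pi * b * x) * sin (2 * pi * b * real (Suc n)))" for n
    by (rule int; simp)+
  have "(\<lambda>n. (LINT b|unit_interval_measure. 2 * (1 - b) * cos (2 * pi * b * x) * cos (2 * pi * b * real (Suc n)))
       - (LINT b|unit_interval_measure. 2 * (1 - b) * sin (2 * pi * b * x) * sin (2 * pi * b * real (Suc n))))
      \<longlonglongrightarrow> 0 - 0"
    by (intro tendsto_diff riemann_lebesgue_unit[where C = "2 * 1 * 1"] le) auto
  then show "(\<lambda>n. LINT b|unit_interval_measure. 2 * (1 - b) * cos (2 * pi * b * (x + real (Suc n)))) \<longlonglongrightarrow> 0"
    unfolding args Bochner_Integration.integral_diff[OF int_cos int_sin] by (simp only: diff_zero)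
qed

section \<open>One-sided bounds by comparison with the limit\<close>

lemma beurling_le_1:
  assumes "x > 0"
  shows "beurling x \<le> 1"
proof -
  have "beurling x \<le> beurling (x + real (Suc n))" for n
  proof (induction n)
    case 0
    then show ?case using beurling_mono_step[OF assms] by simp
  next
    case (Suc n)
    then show ?case using beurling_mono_step[of "x + real (Suc n)"] assms by (simp add: algebra_simps)
  qed
  then show ?thesis
    using beurling_tendsto_1[of x] by (intro LIMSEQ_le_const) auto
qed

lemma beurling_add_fejer_ge_1:
  assumes "x \<ge> 0"
  shows "1 \<le> beurling x + fejer x"
proof (cases "x = 0")
  \<comment> \<open>The step inequalities need a positive argument; at 0 there is equality, because
    \<open>beurling 0 = 0\<close> and \<open>fejer 0 = 1\<close>.\<close>
  case True
  then show ?thesis by (simp add: beurling_def fejer_0)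
next
  case False
  with assms have "x > 0" by simp
  have "beurling (x + real (Suc n)) + fejer (x + real (Suc n)) \<le> beurling x + fejer x" for n
  proof (induction n)
    case 0
    then show ?case using beurling_fejer_antimono_step[OF \<open>x > 0\<close>] by simp
  next
    case (Suc n)
    then show ?case
      using beurling_fejer_antimono_step[of "x + real (Suc n)"] \<open>x > 0\<close> by (simp add: algebra_simps)
  qed
  moreover have "(\<lambda>n. beurling (x + real (Suc n)) + fejer (x + real (Suc n))) \<longlonglongrightarrow> 1 + 0"
    by (intro tendsto_add beurling_tendsto_1 fejer_tendsto_0)
  ultimately show ?thesis by (intro LIMSEQ_le_const2) auto
qed

text \<open>For negative \<open>x\<close>, oddness turns \<open>beurling_le_1\<close> into a lower
  bound, and the Fejer kernel is nonnegative. So \<open>beurling + fejer\<close> majorizes the sign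
  function on the whole line.\<close>

lemma beurling_add_fejer_ge_minus_1: "- 1 \<le> beurling x + fejer x"
proof (cases "x \<ge> 0")
  case True
  then show ?thesis using beurling_add_fejer_ge_1[of x] by simp
next
  case False
  then show ?thesis
    using beurling_le_1[of "- x"] fejer_nonneg[of x] by (simp add: beurling_minus)
qed

section \<open>Selberg's majorant\<close>

text \<open>Density of the cosine transform of the mean of \<open>beurling + fejer\<close> at
  \<open>Y - t\<close> and at \<open>Y + t\<close>: Selberg's majorant of \<open>[-Y, Y]\<close>
  with frequencies at most 1.\<close>

definition selberg_dens :: "real \<Rightarrow> real \<Rightarrow> real" where
  "selberg_dens Y b = beurling_dens b * sin (2 * pi * b * Y) + 2 * (1 - b) * cos (2 * pi * b * Y)"

text \<open>The bound is twice \<open>2 * Y + 1\<close>, the factor 2 again coming from folding; it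
  is the limit of the density at \<open>b = 0\<close>.\<close>

lemma selberg_dens_le:
  assumes "0 < b" "b < 1" "0 \<le> Y"
  shows "\<bar>selberg_dens Y b\<bar> \<le> 4 * Y + 2"
proof -
  have "\<bar>2 * (1 - b) * cos (2 * pi * b * Y)\<bar> \<le> 2 * 1 * 1"
    unfolding abs_mult using assms by (intro mult_mono) auto
  with beurling_dens_sin_le[OF assms(1,2), of Y] assms(3) show ?thesis
    unfolding selberg_dens_def by linarith
qed

lemma borel_measurable_selberg_dens [measurable]: "selberg_dens Y \<in> borel_measurable borel"
  unfolding selberg_dens_def by measurable

text \<open>Inside the interval both \<open>Y - t\<close> and \<open>Y + t\<close> are nonnegative
  and each term is at least 1. Outside, one is negative and the other positive, so the terms are at
  least -1 and 1 and their mean is nonnegative.\<close>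

lemma selberg_majorant:
  assumes "Y \<ge> 0"
  shows "(if \<bar>t\<bar> \<le> Y then 1 else 0) \<le> (LINT b|unit_interval_measure. selberg_dens Y b * cos (2 * pi * b * t))"
proof -
  have "selberg_dens Y b * cos (2 * pi * b * t)
      = (beurling_dens b * sin (2 * pi * b * (Y - t)) + 2 * (1 - b) * cos (2 * pi * b * (Y - t))
        + (beurling_dens b * sin (2 * pi * b * (Y + t)) + 2 * (1 - b) * cos (2 * pi * b * (Y + t)))) / 2" for b
    unfolding selberg_dens_def distrib_left[of _ Y t] right_diff_distrib[of _ Y t]
      sin_add sin_diff cos_add cos_diff by (simp add: algebra_simps add_divide_distrib)
  note eq = this
  have "(LINT b|unit_interval_measure. selberg_dens Y b * cos (2 * pi * b * t))
      = (beurling (Y - t) + fejer (Y - t) + (beurling (Y + t) + fejer (Y + t))) / 2"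
    unfolding eq beurling_def fejer_def
    by (simp only: integral_divide_zero Bochner_Integration.integral_add Bochner_Integration.integrable_add
        integrable_beurling integrable_fejer)
  note eq = this
  show ?thesis
  proof (cases "\<bar>t\<bar> \<le> Y")
    case True
    then have "0 \<le> Y - t" "0 \<le> Y + t" by auto
    from beurling_add_fejer_ge_1[OF this(1)] beurling_add_fejer_ge_1[OF this(2)] True show ?thesis
      by (simp add: eq)
  next
    case False
    then consider "t > Y" | "t < - Y"
      by linarith
    then show ?thesis
    proof cases
      case 1
      then show ?thesis
        using False assms beurling_add_fejer_ge_minus_1[of "Y - t"] beurling_add_fejer_ge_1[of "Y + t"] by (auto simp: eq)
    next
      case 2
      then show ?thesis
        using False assms beurling_add_fejer_ge_minus_1[of "Y + t"] beurling_add_fejer_ge_1[of "Y - t"] by (auto simp: eq)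
    qed
  qed
qed

section \<open>Sums over close pairs\<close>

lemma cmod_exp_sum_sq:
  "(cmod (exp_sum N u \<beta>))\<^sup>2
    = (\<Sum>m = 1..N. \<Sum>n = 1..N. u m * u n * cos (2 * pi * (real m - real n) * \<beta>))"
proof -
  have e: "e x = cis (2 * pi * x)" for x
    by (simp add: e_def cis_conv_exp mult_ac)
  have "Re (exp_sum N u \<beta>) = (\<Sum>n = 1..N. u n * cos (2 * pi * real n * \<beta>))"
    "Im (exp_sum N u \<beta>) = (\<Sum>n = 1..N. u n * sin (2 * pi * real n * \<beta>))"
    by (simp_all add: exp_sum_def e mult.assoc)
  then have "(cmod (exp_sum N u \<beta>))\<^sup>2 = (\<Sum>m = 1..N. \<Sum>n = 1..N.
      u m * cos (2 * pi * real m * \<beta>) * (u n * cos (2 * pi * real n * \<beta>))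
      + u m * sin (2 * pi * real m * \<beta>) * (u n * sin (2 * pi * real n * \<beta>)))"
    unfolding cmod_power2 by (simp add: power2_eq_square sum_product sum.distrib)
  also have "\<dots> = (\<Sum>m = 1..N. \<Sum>n = 1..N. u m * u n * cos (2 * pi * (real m - real n) * \<beta>))"
  proof (intro sum.cong refl)
    fix m n
    have "2 * pi * (real m - real n) * \<beta> = 2 * pi * real m * \<beta> - 2 * pi * real n * \<beta>"
      by (simp add: algebra_simps)
    then show "u m * cos (2 * pi * real m * \<beta>) * (u n * cos (2 * pi * real n * \<beta>))
      + u m * sin (2 * pi * real m * \<beta>) * (u n * sin (2 * pi * real n * \<beta>))
      = u m * u n * cos (2 * pi * (real m - real n) * \<beta>)"
      by (simp only: cos_diff) (simp add: algebra_simps)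
  qed
  finally show ?thesis .
qed

lemma continuous_exp_sum_sq: "continuous_on S (\<lambda>\<beta>. (cmod (exp_sum N u (c * \<beta>)))\<^sup>2)"
  unfolding cmod_exp_sum_sq by (intro continuous_intros)

lemma exp_sum_sq_minus: "(cmod (exp_sum N u (- \<beta>)))\<^sup>2 = (cmod (exp_sum N u \<beta>))\<^sup>2"
  unfolding cmod_exp_sum_sq by simp

lemma integrable_unit_continuous:
  assumes "continuous_on UNIV (f :: real \<Rightarrow> real)"
  shows "integrable unit_interval_measure f"
proof -
  have "bounded (f ` {0..1})"
    by (intro compact_imp_bounded compact_continuous_image continuous_on_subset[OF assms]) auto
  then obtain C where "\<forall>y\<in>f ` {0..1}. norm y \<le> C"
    unfolding bounded_iff by blast
  then show ?thesis
    using assms by (intro integrable_unit[where C = C] borel_measurable_continuous_onI) auto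
qed

lemma integral_symmetric_eq_unit:
  fixes f :: "real \<Rightarrow> real"
  assumes cont: "continuous_on UNIV f" and even: "\<And>\<beta>. f (- \<beta>) = f \<beta>" and "\<delta> > 0"
  shows "(LINT \<beta>:{-\<delta>..\<delta>}|lborel. f \<beta>) = 2 * \<delta> * (LINT b|unit_interval_measure. f (\<delta> * b))"
proof -
  let ?g = "\<lambda>b. indicator {0<..<1} b *\<^sub>R f (\<delta> * b)"
  have [measurable]: "f \<in> borel_measurable borel"
    using cont by (rule borel_measurable_continuous_onI)
  have "integrable unit_interval_measure (\<lambda>b. f (\<delta> * b))"
    by (intro integrable_unit_continuous continuous_on_compose2[OF cont] continuous_intros) auto
  then have int: "integrable lborel ?g"
    by (simp add: integrable_restrict_space)
  then have int': "integrable lborel (\<lambda>b. ?g (- b))"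
    using lborel_integrable_real_affine[of ?g "- 1" 0] by simp
  have "(LINT \<beta>:{-\<delta>..\<delta>}|lborel. f \<beta>) = \<delta> * (LINT b|lborel. indicator {-\<delta>..\<delta>} (\<delta> * b) *\<^sub>R f (\<delta> * b))"
    unfolding set_lebesgue_integral_def
    using lborel_integral_real_affine[of \<delta> "\<lambda>\<beta>. indicator {-\<delta>..\<delta>} \<beta> *\<^sub>R f \<beta>" 0] \<open>\<delta> > 0\<close> by simp
  also have "(LINT b|lborel. indicator {-\<delta>..\<delta>} (\<delta> * b) *\<^sub>R f (\<delta> * b)) = (LINT b|lborel. ?g b + ?g (- b))"
  proof (rule integral_cong_AE)
    \<comment> \<open>The closed interval \<open>[-1, 1]\<close> and the two open halves differ only
      in these points.\<close>
    have "AE b in lborel. b \<noteq> -1 \<and> b \<noteq> 0 \<and> b \<noteq> (1::real)"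
      by (intro AE_conjI AE_lborel_singleton)
    then show "AE b in lborel. indicator {-\<delta>..\<delta>} (\<delta> * b) *\<^sub>R f (\<delta> * b) = ?g b + ?g (- b)"
    proof eventually_elim
      case (elim b)
      have "-\<delta> \<le> \<delta> * b \<longleftrightarrow> -1 \<le> b" "\<delta> * b \<le> \<delta> \<longleftrightarrow> b \<le> 1"
        using \<open>\<delta> > 0\<close> by (auto simp: mult_le_cancel_left2 dest: mult_le_cancel_left_pos[of \<delta> "-1" b, THEN iffD1])
          (use mult_le_cancel_left_pos[of \<delta> "-1" b] in auto)
      then show ?case
        using elim even[of "\<delta> * b"] by (auto simp: indicator_def)
    qed
  qed measurable
  also have "\<dots> = (LINT b|lborel. ?g b) + (LINT b|lborel. ?g (- b))"
    by (rule Bochner_Integration.integral_add[OF int int'])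
  also have "(LINT b|lborel. ?g (- b)) = (LINT b|lborel. ?g b)"
    using lborel_integral_real_affine[of "- 1" ?g 0] by simp
  also have "(LINT b|lborel. ?g b) = (LINT b|unit_interval_measure. f (\<delta> * b))"
    by (simp add: integral_restrict_space)
  finally show ?thesis by simp
qed

text \<open>Nonnegative weights allow the indicator to be replaced by the majorant pair by pair.
  Under the integral the cosines then reassemble into the squared modulus of the exponential sum at
  \<open>\<delta> * b\<close>, which is nonnegative, so the density can be replaced by its
  bound.\<close>

lemma sum_close_pairs_le:
  fixes u :: "nat \<Rightarrow> real"
  assumes "\<delta> > 0" and u: "\<And>n. n \<in> {1..N} \<Longrightarrow> u n \<ge> 0" and "y \<ge> 0"
  shows "(\<Sum>m = 1..N. \<Sum>n = 1..N. u m * u n * (if \<bar>real m - real n\<bar> \<le> y then 1 else 0))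
    \<le> (2 * y + 1 / \<delta>) * (LINT \<beta>:{-\<delta>..\<delta>}|lborel. (cmod (exp_sum N u \<beta>))\<^sup>2)"
proof -
  \<comment> \<open>Rescaling by \<open>\<delta>\<close> carries the frequency range
    \<open>(0, 1)\<close> to \<open>(0, \<delta>)\<close>. The bound \<open>4 * Y + 2\<close>
    becomes \<open>2 * \<delta> * (2 * y + 1 / \<delta>)\<close>.\<close>
  define Y where "Y = \<delta> * y"
  have "Y \<ge> 0" using assms by (simp add: Y_def)
  let ?F = "\<lambda>\<beta>. (cmod (exp_sum N u \<beta>))\<^sup>2"
  let ?K = "\<lambda>t. LINT b|unit_interval_measure. selberg_dens Y b * cos (2 * pi * b * t)"
  have int: "integrable unit_interval_measure (\<lambda>b. selberg_dens Y b * cos (2 * pi * b * t))" for t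
  proof (rule integrable_unit)
    show "\<bar>selberg_dens Y b * cos (2 * pi * b * t)\<bar> \<le> (4 * Y + 2) * 1" if "0 < b" "b < 1" for b
      unfolding abs_mult using selberg_dens_le[OF that \<open>Y \<ge> 0\<close>] by (intro mult_mono) auto
  qed measurable
  have eq: "(\<Sum>m = 1..N. \<Sum>n = 1..N. u m * u n *
        (selberg_dens Y b * cos (2 * pi * b * (\<delta> * (real m - real n)))))
      = selberg_dens Y b * ?F (\<delta> * b)" for b
    unfolding cmod_exp_sum_sq by (simp add: sum_distrib_left mult_ac)
  have intF: "integrable unit_interval_measure (\<lambda>b. ?F (\<delta> * b))"
    by (intro integrable_unit_continuous continuous_exp_sum_sq)
  have intSF: "integrable unit_interval_measure (\<lambda>b. selberg_dens Y b * ?F (\<delta> * b))"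
    unfolding eq[symmetric] by (intro Bochner_Integration.integrable_sum integrable_mult_right int)
  have "(\<Sum>m = 1..N. \<Sum>n = 1..N. u m * u n * (if \<bar>real m - real n\<bar> \<le> y then 1 else 0))
      \<le> (\<Sum>m = 1..N. \<Sum>n = 1..N. u m * u n * ?K (\<delta> * (real m - real n)))"
  proof (intro sum_mono mult_left_mono mult_nonneg_nonneg u)
    fix m n :: nat
    have "\<bar>\<delta> * (real m - real n)\<bar> \<le> Y \<longleftrightarrow> \<bar>real m - real n\<bar> \<le> y"
      using \<open>\<delta> > 0\<close> by (simp add: Y_def abs_mult)
    then show "(if \<bar>real m - real n\<bar> \<le> y then 1 else 0) \<le> ?K (\<delta> * (real m - real n))"
      using selberg_majorant[OF \<open>Y \<ge> 0\<close>, of "\<delta> * (real m - real n)"] by simp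
  qed
  also have "\<dots> = (LINT b|unit_interval_measure. (\<Sum>m = 1..N. \<Sum>n = 1..N. u m * u n *
        (selberg_dens Y b * cos (2 * pi * b * (\<delta> * (real m - real n))))))"
    by (simp add: Bochner_Integration.integral_sum Bochner_Integration.integrable_sum int del: mult_minus_right)
  also have "\<dots> = (LINT b|unit_interval_measure. selberg_dens Y b * ?F (\<delta> * b))"
    by (simp only: eq)
  also have "\<dots> \<le> (LINT b|unit_interval_measure. (4 * Y + 2) * ?F (\<delta> * b))"
  proof (rule integral_mono[OF intSF])
    fix b assume "b \<in> space unit_interval_measure"
    then show "selberg_dens Y b * ?F (\<delta> * b) \<le> (4 * Y + 2) * ?F (\<delta> * b)"
      using selberg_dens_le[of b Y] \<open>Y \<ge> 0\<close> by (intro mult_right_mono) (auto simp: space_unit)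
  qed (intro integrable_mult_right intF)
  also have "\<dots> = (2 * y + 1 / \<delta>) * (2 * \<delta> * (LINT b|unit_interval_measure. ?F (\<delta> * b)))"
    using \<open>\<delta> > 0\<close> by (simp only: integral_mult_right_zero) (simp add: Y_def field_simps)
  also have "2 * \<delta> * (LINT b|unit_interval_measure. ?F (\<delta> * b)) = (LINT \<beta>:{-\<delta>..\<delta>}|lborel. ?F \<beta>)"
    using continuous_exp_sum_sq[of UNIV N u 1] \<open>\<delta> > 0\<close>
    by (intro integral_symmetric_eq_unit[symmetric]) (simp_all add: exp_sum_sq_minus)
  finally show ?thesis .
qed

text \<open>Layer-cake decomposition: a nonincreasing sequence is a combination of indicators of
  \<open>{0..k}\<close> with weights \<open>d k - d (Suc k) \<ge> 0\<close>, and
  \<open>sum_close_pairs_le\<close> applies to each layer.\<close>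

lemma sum_antimono_kernel_le:
  fixes u d :: "nat \<Rightarrow> real"
  assumes "\<delta> > 0" and u: "\<And>n. n \<in> {1..N} \<Longrightarrow> u n \<ge> 0"
    and d: "\<And>k. d (Suc k) \<le> d k" and "\<And>k. d k \<ge> 0"
  shows "(\<Sum>m = 1..N. \<Sum>n = 1..N. u m * u n * d (nat \<bar>int m - int n\<bar>))
    \<le> (d 0 / \<delta> + 2 * (\<Sum>k<N. d (Suc k))) * (LINT \<beta>:{-\<delta>..\<delta>}|lborel. (cmod (exp_sum N u \<beta>))\<^sup>2)"
    (is "?S \<le> _ * ?I")
proof -
  let ?\<chi> = "\<lambda>m n k. if \<bar>real m - real n\<bar> \<le> real k then 1 else 0 :: real"
  define g where "g k = d k - d (Suc k)" for k
  have "?I \<ge> 0"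
    by (simp add: set_lebesgue_integral_def)
  have layers: "d (nat \<bar>int m - int n\<bar>) = (\<Sum>k<N. g k * ?\<chi> m n k) + d N"
    if "m \<in> {1..N}" "n \<in> {1..N}" for m n
  proof -
    define j where "j = nat \<bar>int m - int n\<bar>"
    have "j \<le> N" and \<chi>: "?\<chi> m n k = (if j \<le> k then 1 else 0)" for k
      using that by (auto simp: j_def)
    have "(\<Sum>k<N. g k * ?\<chi> m n k) = (\<Sum>k = j..<N. g k)"
      unfolding \<chi> by (rule sum.mono_neutral_cong_right) auto
    also have "\<dots> = d j - d N"
      using sum_Suc_diff'[OF \<open>j \<le> N\<close>, of d] unfolding g_def
      by (simp add: sum_subtractf)
    finally show ?thesis by (simp add: j_def)
  qed
  \<comment> \<open>Summation by parts: consecutive layer constants differ by 2, and the first one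
    is \<open>1 / \<delta>\<close>.\<close>
  have weights: "(\<Sum>k<M. g k * (2 * real k + 1 / \<delta>)) + d M * (2 * real M + 1 / \<delta>)
      = d 0 / \<delta> + 2 * (\<Sum>k<M. d (Suc k))" for M
    by (induction M) (simp_all add: g_def algebra_simps add_divide_distrib)
  have close: "(\<Sum>m = 1..N. \<Sum>n = 1..N. u m * u n * ?\<chi> m n k) \<le> (2 * real k + 1 / \<delta>) * ?I" for k
    by (rule sum_close_pairs_le[OF \<open>\<delta> > 0\<close> u]) auto
  \<comment> \<open>The constant remainder \<open>d N\<close> becomes one more layer, since all
    differences of indices are at most \<open>N\<close>.\<close>
  have "?S = (\<Sum>m = 1..N. \<Sum>n = 1..N. u m * u n * ((\<Sum>k<N. g k * ?\<chi> m n k) + d N * ?\<chi> m n N))"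
    by (intro sum.cong refl) (auto simp: layers)
  also have "\<dots> = (\<Sum>k<N. g k * (\<Sum>m = 1..N. \<Sum>n = 1..N. u m * u n * ?\<chi> m n k))
      + d N * (\<Sum>m = 1..N. \<Sum>n = 1..N. u m * u n * ?\<chi> m n N)"
  proof -
    have "(\<Sum>m = 1..N. \<Sum>n = 1..N. \<Sum>k<N. g k * (u m * u n * ?\<chi> m n k))
        = (\<Sum>k<N. \<Sum>m = 1..N. \<Sum>n = 1..N. g k * (u m * u n * ?\<chi> m n k))"
      by (subst sum.swap[of _ _ "{..<N}"]) (intro sum.cong refl sum.swap)
    then show ?thesis
      unfolding distrib_left sum.distrib sum_distrib_left by (simp add: mult_ac)
  qed
  also have "\<dots> \<le> (\<Sum>k<N. g k * ((2 * real k + 1 / \<delta>) * ?I)) + d N * ((2 * real N + 1 / \<delta>) * ?I)"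
    using assms by (intro add_mono sum_mono mult_left_mono close) (auto simp: g_def)
  also have "\<dots> = ((\<Sum>k<N. g k * (2 * real k + 1 / \<delta>)) + d N * (2 * real N + 1 / \<delta>)) * ?I"
    by (simp add: sum_distrib_right distrib_right mult.assoc)
  finally show ?thesis by (simp only: weights)
qed

section \<open>Autocorrelations of symmetric decreasing functions\<close>

definition autocorrelation :: "(real \<Rightarrow> real) \<Rightarrow> real \<Rightarrow> real" where
  "autocorrelation a s = (LINT t|lborel. a t * a (t - s))"

lemma integrable_reflect:
  fixes f :: "real \<Rightarrow> real"
  shows "integrable lborel f \<Longrightarrow> integrable lborel (\<lambda>t. f (- t))"
  using lborel_integrable_real_affine[of f "- 1" 0] by simp

locale symmetric_decreasing =
  fixes a :: "real \<Rightarrow> real"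
  assumes nonneg: "a t \<ge> 0"
    and even: "a (- t) = a t"
    and antimono: "antimono_on {0..} a"
    and integrable: "integrable lborel a"
    and integrable_sq: "integrable lborel (\<lambda>t. (a t)\<^sup>2)"
begin

lemma borel_measurable [measurable]: "a \<in> borel_measurable borel"
  using borel_measurable_integrable[OF integrable] by simp

lemma abs_antimono:
  assumes "\<bar>s\<bar> \<le> \<bar>t\<bar>"
  shows "a t \<le> a s"
proof -
  have "a \<bar>x\<bar> = a x" for x
    using even[of x] by (simp add: abs_if)
  moreover have "a \<bar>t\<bar> \<le> a \<bar>s\<bar>"
    using antimono assms by (auto simp: monotone_on_def)
  ultimately show ?thesis by simp
qed

lemma integrable_translate_mult: "integrable lborel (\<lambda>t. a (t - p) * a (t - q))"
proof (rule Bochner_Integration.integrable_bound)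
  have "integrable lborel (\<lambda>t. (a (t - p))\<^sup>2)" for p
    using lborel_integrable_real_affine[OF integrable_sq, of 1 "- p"] by simp
  then show "integrable lborel (\<lambda>t. (a (t - p))\<^sup>2 + (a (t - q))\<^sup>2)"
    by simp
  show "AE t in lborel. norm (a (t - p) * a (t - q)) \<le> norm ((a (t - p))\<^sup>2 + (a (t - q))\<^sup>2)"
  proof (rule AE_I2)
    fix t
    have "2 * (a (t - p) * a (t - q)) \<le> (a (t - p))\<^sup>2 + (a (t - q))\<^sup>2"
      using sum_squares_bound[of "a (t - p)" "a (t - q)"] by simp
    moreover have "a (t - p) * a (t - q) \<ge> 0"
      by (simp add: nonneg)
    ultimately show "norm (a (t - p) * a (t - q)) \<le> norm ((a (t - p))\<^sup>2 + (a (t - q))\<^sup>2)"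
      unfolding real_norm_def by linarith
  qed
qed measurable

lemma integral_translate_mult:
  "(LINT t|lborel. a (t - p) * a (t - q)) = autocorrelation a (q - p)"
  unfolding autocorrelation_def
  using lborel_integral_real_affine[of 1 "\<lambda>t. a (t - p) * a (t - q)" p]
  by (simp add: algebra_simps)

lemma autocorrelation_minus: "autocorrelation a (- s) = autocorrelation a s"
  using integral_translate_mult[of s 0] by (simp add: autocorrelation_def mult.commute)

lemma autocorrelation_nonneg: "autocorrelation a s \<ge> 0"
  by (simp add: autocorrelation_def nonneg)

text \<open>Reflection in the midpoint of \<open>s\<close> and \<open>s'\<close> shows that twice
  the difference of the two autocorrelations is the integral of
  \<open>a t - a (t - (s + s'))\<close> times \<open>a (t - s) - a (t - s')\<close>. Both factors
  are nonnegative left of the midpoint and nonpositive right of it.\<close>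

lemma autocorrelation_antimono:
  assumes "0 \<le> s" "s \<le> s'"
  shows "autocorrelation a s' \<le> autocorrelation a s"
proof -
  let ?g = "\<lambda>t. a (t - s) - a (t - s')"
  have int: "integrable lborel (\<lambda>t. a (t - p) * ?g t)" for p
    by (simp only: right_diff_distrib) (intro Bochner_Integration.integrable_diff integrable_translate_mult)
  have "a (s' + s - t) = a (t - (s' + s))" for t
    using even[of "t - (s' + s)"] by simp
  have diff: "autocorrelation a s - autocorrelation a s' = (LINT t|lborel. a (t - 0) * ?g t)"
    unfolding right_diff_distrib
    by (subst Bochner_Integration.integral_diff)
       (use integrable_translate_mult[of 0] in \<open>simp_all add: autocorrelation_def\<close>)
  text \<open>The reflection \<open>t \<mapsto> s + s' - t\<close> changes the sign of \<open>?g\<close>.\<close>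
  have "(LINT t|lborel. a (t - 0) * ?g t)
      = (LINT t|lborel. a (s + s' - t) * (a (s' - t) - a (s - t)))"
    using lborel_integral_real_affine[of "- 1" "\<lambda>t. a (t - 0) * ?g t" "s + s'"] by (simp add: algebra_simps)
  also have "\<dots> = (LINT t|lborel. - (a (t - (s + s')) * ?g t))"
    using even[of "_ - s"] even[of "_ - s'"] even[of "_ - (s + s')"] by (simp add: algebra_simps)
  finally have refl: "(LINT t|lborel. a (t - 0) * ?g t) = - (LINT t|lborel. a (t - (s + s')) * ?g t)"
    by simp
  have "0 \<le> (LINT t|lborel. (a (t - 0) - a (t - (s + s'))) * ?g t)"
  proof (rule Bochner_Integration.integral_nonneg)
    fix t
    \<comment> \<open>Both comparisons of distances are decided by the sign of
      \<open>s + s' - 2 * t\<close>.\<close>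
    have sq: "(t - (s + s'))\<^sup>2 - (t - 0)\<^sup>2 = (s + s') * (s + s' - 2 * t)"
      "(t - s')\<^sup>2 - (t - s)\<^sup>2 = (s' - s) * (s + s' - 2 * t)"
      by (simp_all add: power2_eq_square algebra_simps)
    consider "2 * t \<le> s + s'" | "s + s' \<le> 2 * t" by linarith
    then show "0 \<le> (a (t - 0) - a (t - (s + s'))) * ?g t"
    proof cases
      case 1
      then have "0 \<le> (s + s') * (s + s' - 2 * t)" "0 \<le> (s' - s) * (s + s' - 2 * t)"
        using assms by auto
      then have "\<bar>t - 0\<bar> \<le> \<bar>t - (s + s')\<bar>" "\<bar>t - s\<bar> \<le> \<bar>t - s'\<bar>"
        unfolding abs_le_square_iff sq[symmetric] by auto
      from abs_antimono[OF this(1)] abs_antimono[OF this(2)] show ?thesis by simp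
    next
      case 2
      then have "(s + s') * (s + s' - 2 * t) \<le> 0" "(s' - s) * (s + s' - 2 * t) \<le> 0"
        using assms by (auto simp: mult_le_0_iff)
      then have "\<bar>t - (s + s')\<bar> \<le> \<bar>t - 0\<bar>" "\<bar>t - s'\<bar> \<le> \<bar>t - s\<bar>"
        unfolding abs_le_square_iff sq[symmetric] by auto
      from abs_antimono[OF this(1)] abs_antimono[OF this(2)] show ?thesis
        by (intro mult_nonpos_nonpos) simp_all
    qed
  qed
  also have "\<dots> = (LINT t|lborel. a (t - 0) * ?g t) - (LINT t|lborel. a (t - (s + s')) * ?g t)"
    unfolding left_diff_distrib by (rule Bochner_Integration.integral_diff[OF int int])
  finally show ?thesis
    using refl diff by linarith
qed

text \<open>Fubini: for fixed \<open>t\<close>, integrating \<open>a (t - s)\<close> over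
  \<open>s\<close> gives the full integral of \<open>a\<close>.\<close>

lemma integrable_autocorrelation: "integrable lborel (autocorrelation a)"
  and integral_autocorrelation: "(LINT s|lborel. autocorrelation a s) = B_const a"
proof -
  have shift: "integrable lborel (\<lambda>s. a (t - s))" "(LINT s|lborel. a (t - s)) = (LINT s|lborel. a s)" for t
    using lborel_integrable_real_affine[OF integrable, of "- 1" t]
      lborel_integral_real_affine[of "- 1" a t] by simp_all
  have int: "integrable (lborel \<Otimes>\<^sub>M lborel) (\<lambda>(t, s). a t * a (t - s))"
  proof (rule lborel_pair.Fubini_integrable)
    show "integrable lborel (\<lambda>t. LINT s|lborel. norm (case (t, s) of (t, s) \<Rightarrow> a t * a (t - s)))"
      by (simp add: nonneg shift abs_mult integrable)
    show "AE t in lborel. integrable lborel (\<lambda>s. case (t, s) of (t, s) \<Rightarrow> a t * a (t - s))"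
      by (simp add: shift)
  qed measurable
  show "integrable lborel (autocorrelation a)"
    using lborel_pair.integrable_snd[OF int] by (simp add: autocorrelation_def[abs_def])
  show "(LINT s|lborel. autocorrelation a s) = B_const a"
    using lborel_pair.Fubini_integral[OF int]
    by (simp add: autocorrelation_def shift B_const_def power2_eq_square)
qed

text \<open>By monotonicity the sum is a lower Riemann sum over the positive half-line; evenness
  gives the same on the negative half-line, which accounts for the factor 2.\<close>

lemma sum_autocorrelation_le:
  "2 * (\<Sum>k<M. autocorrelation a (real (Suc k))) \<le> B_const a"
proof -
  let ?D = "autocorrelation a"
  \<comment> \<open>Each cell takes the value at its right end. The cells omit 0, so this step
    function and its reflection have disjoint supports.\<close>
  let ?g = "\<lambda>M s. (\<Sum>k<M. indicator {real k<..real (Suc k)} s * ?D (real (Suc k)))"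
  have int_g: "integrable lborel (?g M)" for M
    by (intro Bochner_Integration.integrable_sum integrable_mult_left) simp
  have int_g': "integrable lborel (\<lambda>s. ?g M (- s))" for M
    by (rule integrable_reflect[OF int_g])
  have g_zero: "?g M s = 0" if "s \<le> 0 \<or> s > real M" for M s
    using that by (intro sum.neutral) auto
  have g_le: "?g M s \<le> ?D s" for M s
  proof (induction M)
    case 0
    then show ?case by (simp add: autocorrelation_nonneg)
  next
    case (Suc M)
    show ?case
    proof (cases "s \<in> {real M<..real (Suc M)}")
      case True
      then show ?thesis
        using g_zero[of s M] autocorrelation_antimono[of s "real (Suc M)"] by auto
    next
      case False
      with Suc show ?thesis by simp
    qed
  qed
  have "(LINT s|lborel. ?g M s) = (\<Sum>k<M. ?D (real (Suc k)))"
    by (subst Bochner_Integration.integral_sum) (auto intro!: integrable_mult_left)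
  moreover have "(LINT s|lborel. ?g M (- s)) = (LINT s|lborel. ?g M s)"
    using lborel_integral_real_affine[of "- 1" "?g M" 0] by simp
  ultimately have "2 * (\<Sum>k<M. ?D (real (Suc k))) = (LINT s|lborel. ?g M s + ?g M (- s))"
    by (subst Bochner_Integration.integral_add[OF int_g int_g']) simp
  also have "\<dots> \<le> (LINT s|lborel. ?D s)"
  proof (rule integral_mono)
    show "integrable lborel (\<lambda>s. ?g M s + ?g M (- s))"
      by (rule Bochner_Integration.integrable_add[OF int_g int_g'])
    show "?g M s + ?g M (- s) \<le> ?D s" for s
    proof (cases "s \<ge> 0")
      case True
      then show ?thesis using g_le[of s M] g_zero[of "- s" M] by simp
    next
      case False
      then show ?thesis
        using g_le[of "- s" M] g_zero[of s M] by (simp add: autocorrelation_minus)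
    qed
  qed (rule integrable_autocorrelation)
  finally show ?thesis by (simp only: integral_autocorrelation)
qed

text \<open>Expanding the square turns the integral into a quadratic form in the autocorrelation at
  integer differences. Free of division, this form of the first part also serves for the window of
  the second part.\<close>

lemma integral_smoothed_sum_sq_le:
  fixes u :: "nat \<Rightarrow> real"
  assumes "\<delta> > 0" "\<And>n. n \<in> {1..N} \<Longrightarrow> u n \<ge> 0"
  shows "(LINT t|lborel. \<bar>\<Sum>m = 1..N. u m * a (t - real m)\<bar>\<^sup>2)
    \<le> (inverse \<delta> * A_const a + B_const a) * (LINT \<beta>:{-\<delta>..\<delta>}|lborel. (cmod (exp_sum N u \<beta>))\<^sup>2)"
    (is "_ \<le> _ * ?I")
proof -
  have "\<bar>\<Sum>m = 1..N. u m * a (t - real m)\<bar>\<^sup>2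
      = (\<Sum>m = 1..N. \<Sum>n = 1..N. u m * u n * (a (t - real m) * a (t - real n)))" for t
    unfolding power2_abs unfolding power2_eq_square sum_product by (simp add: mult_ac)
  then have "(LINT t|lborel. \<bar>\<Sum>m = 1..N. u m * a (t - real m)\<bar>\<^sup>2)
      = (\<Sum>m = 1..N. \<Sum>n = 1..N. u m * u n * autocorrelation a (real n - real m))"
    by (simp add: Bochner_Integration.integral_sum Bochner_Integration.integrable_sum
        integrable_translate_mult integral_translate_mult)
  also have "\<dots> = (\<Sum>m = 1..N. \<Sum>n = 1..N. u m * u n * autocorrelation a (real (nat \<bar>int m - int n\<bar>)))"
  proof (intro sum.cong refl)
    fix m n
    have "real (nat \<bar>int m - int n\<bar>) = real n - real m \<or> real (nat \<bar>int m - int n\<bar>) = - (real n - real m)"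
      by linarith
    then have "autocorrelation a (real n - real m) = autocorrelation a (real (nat \<bar>int m - int n\<bar>))"
      by (elim disjE) (simp_all only: autocorrelation_minus)
    then show "u m * u n * autocorrelation a (real n - real m)
        = u m * u n * autocorrelation a (real (nat \<bar>int m - int n\<bar>))"
      by simp
  qed
  also have "\<dots> \<le> (autocorrelation a (real 0) / \<delta> + 2 * (\<Sum>k<N. autocorrelation a (real (Suc k)))) * ?I"
    by (rule sum_antimono_kernel_le) (auto simp: assms autocorrelation_nonneg intro!: autocorrelation_antimono)
  also have "\<dots> \<le> (inverse \<delta> * A_const a + B_const a) * ?I"
  proof (rule mult_right_mono)
    show "?I \<ge> 0" by (simp add: set_lebesgue_integral_def)
    have "autocorrelation a (real 0) = A_const a"
      by (simp add: autocorrelation_def A_const_def power2_eq_square)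
    then show "autocorrelation a (real 0) / \<delta> + 2 * (\<Sum>k<N. autocorrelation a (real (Suc k)))
        \<le> inverse \<delta> * A_const a + B_const a"
      using sum_autocorrelation_le[of N] by (simp add: field_simps)
  qed
  finally show ?thesis .
qed

end

section \<open>The rectangular window and the second inequality\<close>

lemma integrable_indicator_Icc: "integrable lborel (indicator {c..d} :: real \<Rightarrow> real)"
  by (rule integrable_real_indicator) (auto simp: emeasure_lborel_Icc_eq)

lemma indicator_sq: "(indicator S t :: real)\<^sup>2 = indicator S t"
  by (simp add: indicator_def)

lemma symmetric_decreasing_indicator:
  "symmetric_decreasing (indicator {-r..r} :: real \<Rightarrow> real)"
proof
  show "antimono_on {0..} (indicator {-r..r} :: real \<Rightarrow> real)"
    by (auto simp: monotone_on_def indicator_def)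
  show "integrable lborel (\<lambda>t. (indicator {-r..r} t :: real)\<^sup>2)"
    unfolding indicator_sq by (rule integrable_indicator_Icc)
qed (auto simp: integrable_indicator_Icc indicator_def)

text \<open>Cauchy-Schwarz, carried out as nonnegativity of the squared distance between the
  smoothed sum and a constant \<open>c\<close> on the window \<open>?W\<close> containing its
  support.\<close>

lemma sum_sq_le_smoothed_sum_sq:
  fixes u :: "nat \<Rightarrow> real"
  assumes "M > 0" "N \<ge> 1"
  shows "(M * (\<Sum>m = 1..N. u m))\<^sup>2
    \<le> (real N + M) * (LINT t|lborel. \<bar>\<Sum>m = 1..N. u m * indicator {-(M / 2)..M / 2} (t - real m)\<bar>\<^sup>2)"
    (is "?s\<^sup>2 \<le> _ * ?J")
proof -
  let ?f = "\<lambda>t. \<Sum>m = 1..N. u m * indicator {-(M / 2)..M / 2} (t - real m)"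
  let ?W = "{1 - M / 2..real N + M / 2}"
  \<comment> \<open>The total mass spread over length \<open>real N + M\<close>. The window itself
    has length \<open>real N - 1 + M\<close>, and the loss of 1 is what gives the stated
    constant.\<close>
  define c where "c = ?s / (real N + M)"
  have shift: "indicator {-(M / 2)..M / 2} (t - real m) = (indicator {real m - M / 2..real m + M / 2} t :: real)" for t m
    by (auto simp: indicator_def)
  have f_eq: "?f = (\<lambda>t. \<Sum>m = 1..N. u m * indicator {real m - M / 2..real m + M / 2} t)"
    by (simp only: shift)
  have int_f: "integrable lborel ?f"
    unfolding f_eq by (intro Bochner_Integration.integrable_sum integrable_mult_right integrable_indicator_Icc)
  have int_f_sq: "integrable lborel (\<lambda>t. \<bar>?f t\<bar>\<^sup>2)"
  proof -
    have "\<bar>?f t\<bar>\<^sup>2 = (\<Sum>m = 1..N. \<Sum>n = 1..N. u m * u n *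
        indicator {max (real m - M / 2) (real n - M / 2)..min (real m + M / 2) (real n + M / 2)} t)" for t
      unfolding power2_abs shift unfolding power2_eq_square sum_product
      by (intro sum.cong refl) (auto simp: indicator_def)
    then show ?thesis
      by (simp only:) (intro Bochner_Integration.integrable_sum integrable_mult_right integrable_indicator_Icc)
  qed
  have integral_f: "(LINT t|lborel. ?f t) = ?s"
    unfolding f_eq using \<open>M > 0\<close>
    by (subst Bochner_Integration.integral_sum)
       (auto intro!: integrable_mult_right integrable_indicator_Icc simp: sum_distrib_left mult.commute)
  have support: "?f t * indicator ?W t = ?f t" for t
  proof (cases "t \<in> ?W")
    case False
    then have "?f t = 0"
      by (intro sum.neutral) (auto simp: indicator_def)
    then show ?thesis by (simp only: mult_zero_left)
  qed simp
  have "0 \<le> (LINT t|lborel. (?f t - c * indicator ?W t)\<^sup>2)"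
    by simp
  also have "\<dots> = (LINT t|lborel. \<bar>?f t\<bar>\<^sup>2 - 2 * c * ?f t + c\<^sup>2 * indicator ?W t)"
  proof (rule Bochner_Integration.integral_cong[OF refl])
    fix t
    have "(x - c * i)\<^sup>2 = x\<^sup>2 - 2 * c * (x * i) + c\<^sup>2 * i\<^sup>2" for x i :: real
      by (simp add: power2_eq_square algebra_simps)
    from this[of "?f t" "indicator ?W t"]
    show "(?f t - c * indicator ?W t)\<^sup>2 = \<bar>?f t\<bar>\<^sup>2 - 2 * c * ?f t + c\<^sup>2 * indicator ?W t"
      unfolding support indicator_sq power2_abs .
  qed
  also have "\<dots> = ?J - 2 * c * ?s + c\<^sup>2 * (LINT t|lborel. indicator ?W t)"
    unfolding integral_f[symmetric]
    by (simp only: Bochner_Integration.integral_add Bochner_Integration.integral_diff integral_mult_right_zero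
        Bochner_Integration.integrable_diff integrable_mult_right int_f int_f_sq integrable_indicator_Icc)
  also have "(LINT t|lborel. indicator ?W t) = real N - 1 + M"
    using assms by simp
  also have "?J - 2 * c * ?s + c\<^sup>2 * (real N - 1 + M) \<le> ?J - 2 * c * ?s + c\<^sup>2 * (real N + M)"
    by (intro add_left_mono mult_left_mono) auto
  also have "\<dots> = ?J - ?s\<^sup>2 / (real N + M)"
  proof -
    have "c * (real N + M) = ?s"
      using assms by (simp add: c_def)
    then have "c\<^sup>2 * (real N + M) = c * ?s"
      by (simp only: power2_eq_square mult.assoc)
    moreover have "?s\<^sup>2 / (real N + M) = c * ?s"
      by (simp add: c_def power2_eq_square)
    ultimately show ?thesis by simp
  qed
  finally show ?thesis
    using assms by (simp add: field_simps)
qed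

text \<open>This \<open>M\<close> minimizes
  \<open>(inverse \<delta> * M + M\<^sup>2) * (N + M) / M\<^sup>2\<close>. With
  \<open>s = sqrt (\<delta> * N)\<close> and \<open>w = sqrt (\<delta> * N + 1)\<close> the minimum
  over \<open>N\<close> is \<open>(1 + s)\<^sup>2 / s\<^sup>2\<close>, while the stated factor is
  \<open>(w - 1) / (w + 1) = s\<^sup>2 / (1 + w)\<^sup>2\<close>, because
  \<open>w\<^sup>2 - 1 = s\<^sup>2\<close>. The claim reduces to \<open>s \<le> w\<close>.\<close>

lemma selberg_window_constant:
  assumes "N > 0" "\<delta> > 0"
  defines "M \<equiv> sqrt (N / \<delta>)"
  shows "(1 - 2 / (1 + sqrt (\<delta> * N + 1))) * ((inverse \<delta> * M + M\<^sup>2) * (N + M)) \<le> N * M\<^sup>2"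
proof -
  define s where "s = sqrt (\<delta> * N)"
  define w where "w = sqrt (\<delta> * N + 1)"
  have "s > 0" "w > 0" "s \<le> w" and w_sq: "w\<^sup>2 = s\<^sup>2 + 1"
    using assms by (auto simp: s_def w_def add_pos_pos)
  have M: "M = s / \<delta>" and N: "N = s\<^sup>2 / \<delta>"
    using assms by (auto simp: M_def s_def real_sqrt_divide real_sqrt_mult field_simps simp flip: power2_eq_square)
  have "1 - 2 / (1 + w) = s\<^sup>2 / (1 + w)\<^sup>2"
    using \<open>w > 0\<close> w_sq by (simp add: divide_simps) (simp add: power2_eq_square algebra_simps)
  also have "\<dots> \<le> s\<^sup>2 / (1 + s)\<^sup>2"
    using \<open>s > 0\<close> \<open>s \<le> w\<close> by (intro divide_left_mono power_mono mult_pos_pos) auto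
  finally have "1 - 2 / (1 + w) \<le> s\<^sup>2 / (1 + s)\<^sup>2" .
  then have "(1 - 2 / (1 + w)) * ((inverse \<delta> * M + M\<^sup>2) * (N + M))
      \<le> s\<^sup>2 / (1 + s)\<^sup>2 * ((inverse \<delta> * M + M\<^sup>2) * (N + M))"
    using \<open>s > 0\<close> \<open>\<delta> > 0\<close> by (intro mult_right_mono) (auto simp: M N)
  also have "\<dots> = s\<^sup>2 / (1 + s)\<^sup>2 * ((1 + s)\<^sup>2 * (s\<^sup>2 / \<delta> ^ 3))"
    using \<open>\<delta> > 0\<close>
    by (intro arg_cong[of _ _ "(*) _"]) (simp add: M N field_simps power2_eq_square power3_eq_cube)
  also have "\<dots> = s\<^sup>2 * (s\<^sup>2 / \<delta> ^ 3)"
    using \<open>s > 0\<close> by simp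
  also have "\<dots> = N * M\<^sup>2"
    using \<open>\<delta> > 0\<close> by (simp add: M N field_simps power2_eq_square power3_eq_cube)
  finally show ?thesis by (simp add: w_def)
qed

theorem lemma9p1:
  fixes N :: nat and \<delta> :: real and u :: "nat \<Rightarrow> real"
  assumes "N \<ge> 1" and "\<delta> > 0" and "\<And>n. 1 \<le> n \<Longrightarrow> n \<le> N \<Longrightarrow> u n \<ge> 0"
  shows "(\<forall>a :: real \<Rightarrow> real.
            (\<forall>t. a t \<ge> 0) \<and> (\<forall>t. a (- t) = a t) \<and> riemann_integrable a \<and>
            integrable lborel (\<lambda>t. (a t)\<^sup>2) \<and> integrable lborel a \<and>
            \<not> (AE t in lborel. a t = 0) \<and> antimono_on {0..} a \<longrightarrow>
            (LINT \<beta>:{-\<delta>..\<delta>}|lborel. (cmod (exp_sum N u \<beta>))\<^sup>2)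
              \<ge> 1 / (inverse \<delta> * A_const a + B_const a)
                  * (LINT t|lborel. \<bar>\<Sum>m = 1..N. u m * a (t - real m)\<bar>\<^sup>2))
       \<and> real N * (LINT \<beta>:{-\<delta>..\<delta>}|lborel. (cmod (exp_sum N u \<beta>))\<^sup>2)
            \<ge> (1 - 2 / (1 + sqrt (\<delta> * real N + 1))) * (cmod (exp_sum N u 0))\<^sup>2"
    (is "(\<forall>a. ?P a \<longrightarrow> 1 / ?K a * ?J a \<le> ?I) \<and> ?c * _ \<le> _")
proof (intro conjI allI impI)
  have "?I \<ge> 0"
    by (simp add: set_lebesgue_integral_def)
  have u: "n \<in> {1..N} \<Longrightarrow> u n \<ge> 0" for n
    using assms(3) by simp
  {
    fix a :: "real \<Rightarrow> real"
    assume "?P a"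
    then interpret symmetric_decreasing a
      by unfold_locales auto
    have "?K a \<ge> 0"
      using \<open>\<delta> > 0\<close> by (simp add: A_const_def B_const_def)
    then show "1 / ?K a * ?J a \<le> ?I"
      using integral_smoothed_sum_sq_le[OF \<open>\<delta> > 0\<close> u] \<open>?I \<ge> 0\<close>
      \<comment> \<open>If the denominator is 0, division yields 0 and the claim is
        \<open>?I \<ge> 0\<close>; otherwise the positive denominator is cleared.\<close>
      by (cases "?K a = 0") (simp_all add: field_simps)
  }
  define M where "M = sqrt (real N / \<delta>)"
  have "M > 0"
    using assms by (simp add: M_def)
  define S where "S = (\<Sum>n = 1..N. u n)"
  let ?a = "indicator {-(M / 2)..M / 2} :: real \<Rightarrow> real"
  have "exp_sum N u 0 = of_real S"
    by (simp add: exp_sum_def e_def S_def)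
  then have S: "(cmod (exp_sum N u 0))\<^sup>2 = S\<^sup>2"
    by simp
  have K: "?K ?a = inverse \<delta> * M + M\<^sup>2"
    using \<open>M > 0\<close> by (simp add: A_const_def B_const_def indicator_sq)
  have "(M * S)\<^sup>2 \<le> (real N + M) * ?J ?a"
    unfolding S_def by (rule sum_sq_le_smoothed_sum_sq[OF \<open>M > 0\<close> \<open>N \<ge> 1\<close>])
  also have "\<dots> \<le> (real N + M) * ((inverse \<delta> * M + M\<^sup>2) * ?I)"
    using symmetric_decreasing.integral_smoothed_sum_sq_le[OF symmetric_decreasing_indicator[of "M / 2"] \<open>\<delta> > 0\<close> u]
      \<open>M > 0\<close> unfolding K by (intro mult_left_mono) auto
  finally have MS: "(M * S)\<^sup>2 \<le> (inverse \<delta> * M + M\<^sup>2) * (real N + M) * ?I"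
    by (simp add: mult_ac)
  have "?c \<ge> 0"
    using assms by (simp add: field_simps add_nonneg_pos)
  \<comment> \<open>Everything is kept multiplied by \<open>M\<^sup>2\<close>, the form in which
    \<open>selberg_window_constant\<close> applies; the positive factor is cancelled at the
    end.\<close>
  have "M\<^sup>2 * (?c * S\<^sup>2) = ?c * (M * S)\<^sup>2"
    by (simp add: power_mult_distrib)
  also have "\<dots> \<le> ?c * ((inverse \<delta> * M + M\<^sup>2) * (real N + M) * ?I)"
    by (rule mult_left_mono[OF MS \<open>?c \<ge> 0\<close>])
  also have "\<dots> = ?c * ((inverse \<delta> * M + M\<^sup>2) * (real N + M)) * ?I"
    by (simp only: mult.assoc)
  also have "\<dots> \<le> real N * M\<^sup>2 * ?I"
    using selberg_window_constant[of "real N" \<delta>] assms \<open>?I \<ge> 0\<close>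
    unfolding M_def by (intro mult_right_mono) auto
  finally have "M\<^sup>2 * (?c * S\<^sup>2) \<le> M\<^sup>2 * (real N * ?I)"
    by (simp only: mult_ac)
  then show "?c * (cmod (exp_sum N u 0))\<^sup>2 \<le> real N * ?I"
    using \<open>M > 0\<close> unfolding S by (simp only: mult_le_cancel_left_pos zero_less_power)
qed

end
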